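(* Let $n\ge 1$, $a\ge 3$ and $q\ge 1$ be integers, and let $K_{n,n}$ be the complete bipartite graph with both parts of size $n$. If $K_{n,n}$ has an equitable $(q,1,1)$-tree-coloring in which every color class has size either $a$ or $a+1$, then the equation $ax+(a+1)y=n$ has two solutions $(x_1,y_1)$ and $(x_2,y_2)$ in nonnegative integers (not necessarily different) such that $q=(x_1+y_1)+(x_2+y_2)$.
   Context: A $q$-coloring of a graph $G$ is a map $f:V(G)\to\{1,\dots,q\}$ (not necessarily surjective) with color classes $V_i=f^{-1}(i)$; it is equitable if $||V_i|-|V_j||\le 1$ for all $i,j$. It is a $(q,1,1)$-tree-coloring if for every $i$, each connected component of $G[V_i]$ is a tree of maximum degree at most $1$ and diameter at most $1$ (i.e., $G[V_i]$ is a matching plus isolated vertices). *)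

theory Defs
  imports "Graph_Theory.Graph_Theory"
begin

text \<open>
  An undirected simple graph is a \<open>graph\<close> of \<open>Graph_Theory\<close>, i.e. a finite symmetric
  loop-free digraph without parallel arcs; each edge is represented by its two opposite arcs.
  Consequently the degree of a vertex is its out-degree, and the connected components are the
  strongly connected components \<open>sccs\<close>.

  The library predicates \<open>forest\<close> and \<open>tree\<close> cannot be used for such graphs: an edge and its
  reverse form a \<open>cycle\<close> of length 2, so no edge would be allowed. Undirected cycles are the
  \<open>cycle\<close>s of length at least 3.
\<close>

definition undirected_tree :: "('a, 'b) pre_digraph \<Rightarrow> bool" where
  "undirected_tree G \<longleftrightarrow>
    Digraph_Component.connected G \<and> \<not> (\<exists>p. pre_digraph.cycle G p \<and> 3 \<le> length p)"

definition max_degree :: "('a, 'b) pre_digraph \<Rightarrow> nat" where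
  "max_degree G = Max (out_degree G ` verts G)"

definition diameter :: "('a, 'b) pre_digraph \<Rightarrow> ereal" where
  "diameter G = (SUP u\<in>verts G. SUP v\<in>verts G. wf_digraph.\<mu> G (\<lambda>_. 1) u v)"

definition coloring :: "nat \<Rightarrow> ('a, 'b) pre_digraph \<Rightarrow> ('a \<Rightarrow> nat) \<Rightarrow> bool" where
  "coloring q G f \<longleftrightarrow> f ` verts G \<subseteq> {1..q}"

definition color_class :: "('a, 'b) pre_digraph \<Rightarrow> ('a \<Rightarrow> nat) \<Rightarrow> nat \<Rightarrow> 'a set" where
  "color_class G f i = {v \<in> verts G. f v = i}"

definition equitable :: "nat \<Rightarrow> ('a, 'b) pre_digraph \<Rightarrow> ('a \<Rightarrow> nat) \<Rightarrow> bool" where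
  "equitable q G f \<longleftrightarrow> (\<forall>i\<in>{1..q}. \<forall>j\<in>{1..q}.
    \<bar>int (card (color_class G f i)) - int (card (color_class G f j))\<bar> \<le> 1)"

definition tree_coloring :: "nat \<Rightarrow> nat \<Rightarrow> nat \<Rightarrow> ('a, 'b) pre_digraph \<Rightarrow> ('a \<Rightarrow> nat) \<Rightarrow> bool" where
  "tree_coloring q k d G f \<longleftrightarrow> coloring q G f \<and>
    (\<forall>i\<in>{1..q}. \<forall>C\<in>pre_digraph.sccs (G \<restriction> color_class G f i).
      undirected_tree C \<and> max_degree C \<le> k \<and> diameter C \<le> ereal (real d))"

end

theory Submission
  imports Defs
begin

text \<open>
  If a color class met both parts of the bipartition, then, having at least three vertices, it
  would contain a vertex together with two of its neighbours, i.e. a vertex of degree 2 in the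
  induced subgraph. So every class lies inside one part, and each part is a disjoint union of
  classes of sizes \<open>a\<close> and \<open>a + 1\<close>; counting the classes by size within each part gives the
  two solutions.
\<close>

text \<open>The bound on \<open>max_degree\<close> concerns single components. It transfers to the
  whole class because the component of \<open>u\<close> contains every neighbour of \<open>u\<close>
  in the class, so passing to it preserves the degree of \<open>u\<close>.\<close>

lemma tree_coloring_out_degree_le:
  assumes "graph G" and tc: "tree_coloring q k d G f"
    and i: "i \<in> {1..q}" and u: "u \<in> color_class G f i"
  shows "out_degree (G \<restriction> color_class G f i) u \<le> k"
proof -
  interpret G: graph G by fact
  define H where "H = G \<restriction> color_class G f i"
  have "color_class G f i \<subseteq> verts G" by (auto simp: color_class_def)
  then have ind: "induced_subgraph H G" unfolding H_def by (rule G.induced_induce)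
  interpret H: fin_digraph H
    using ind by (intro G.fin_digraph_subgraph) auto
  interpret H: sym_digraph H
    using induced_graph_imp_symmetric[OF G.sym_arcs ind] by unfold_locales
  \<comment> \<open>By symmetry of \<open>H\<close>, the vertices reachable from \<open>u\<close>
    induce a strongly connected component.\<close>
  define C where "C = H \<restriction> {v. u \<rightarrow>\<^sup>*\<^bsub>H\<^esub> v}"
  have uH: "u \<in> verts H" using u by (simp add: H_def)
  then have "C \<in> H.sccs" unfolding C_def by (rule H.induce_reachable_is_in_sccs)
  then have deg: "max_degree C \<le> k"
    using tc i unfolding tree_coloring_def H_def by blast
  have "verts C \<subseteq> verts H" by (auto simp: C_def dest: H.reachable_in_verts)
  then have fin: "finite (verts C)" by (rule finite_subset) simp
  have "u \<in> verts C" using uH by (simp add: C_def)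
  then have "out_degree C u \<le> max_degree C" unfolding max_degree_def using fin by simp
  \<comment> \<open>An arc of \<open>H\<close> leaving \<open>u\<close> ends at a vertex reachable
    from \<open>u\<close>, so it survives the restriction to \<open>C\<close>.\<close>
  moreover have "out_arcs C u = out_arcs H u"
    using uH by (auto simp: out_arcs_def C_def dest: H.in_arcs_imp_in_arcs_ends)
  ultimately show ?thesis using deg unfolding out_degree_def H_def by simp
qed

text \<open>Distinct \<open>v\<close> and \<open>w\<close> would be the heads of two distinct arcs
  leaving \<open>u\<close> inside its class, giving out-degree at least 2.\<close>

lemma tree_coloring_1_neighbours_eq:
  assumes "graph G" and tc: "tree_coloring q 1 d G f" and i: "i \<in> {1..q}"
    and uvw: "u \<in> color_class G f i" "v \<in> color_class G f i" "w \<in> color_class G f i"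
    and adj: "u \<rightarrow>\<^bsub>G\<^esub> v" "u \<rightarrow>\<^bsub>G\<^esub> w"
  shows "v = w"
proof (rule ccontr)
  assume "v \<noteq> w"
  interpret G: graph G by fact
  let ?H = "G \<restriction> color_class G f i"
  obtain e e' where e: "e \<in> arcs G" "tail G e = u" "head G e = v"
    "e' \<in> arcs G" "tail G e' = u" "head G e' = w"
    using adj by (auto simp: arcs_ends_conv)
  then have "{e, e'} \<subseteq> out_arcs ?H u" using uvw by (simp add: out_arcs_def)
  moreover have "finite (out_arcs ?H u)"
    by (rule finite_subset[OF _ G.finite_arcs]) (auto simp: out_arcs_def)
  ultimately have "card {e, e'} \<le> out_degree ?H u" unfolding out_degree_def by (intro card_mono)
  moreover have "e \<noteq> e'" using e \<open>v \<noteq> w\<close> by auto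
  ultimately show False
    using tree_coloring_out_degree_le[OF \<open>graph G\<close> tc i uvw(1)] by simp
qed

lemma tree_coloring_1_class_in_part:
  assumes "graph G" and tc: "tree_coloring q 1 d G f" and i: "i \<in> {1..q}"
    and parts: "verts G = U \<union> V" "arcs_ends G = U \<times> V \<union> V \<times> U"
    and card: "3 \<le> card (color_class G f i)"
  shows "color_class G f i \<subseteq> U \<or> color_class G f i \<subseteq> V"
proof (rule ccontr)
  let ?S = "color_class G f i"
  assume "\<not> (?S \<subseteq> U \<or> ?S \<subseteq> V)"
  moreover have SUV: "?S \<subseteq> U \<union> V" using parts(1) by (auto simp: color_class_def)
  ultimately obtain u v where uv: "u \<in> ?S" "u \<in> U" "v \<in> ?S" "v \<in> V" "u \<notin> V" "v \<notin> U" by blast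
  have "\<not> ?S \<subseteq> {u, v}"
  proof
    assume "?S \<subseteq> {u, v}"
    then have "card ?S \<le> card {u, v}" by (intro card_mono) auto
    also have "\<dots> \<le> 2" by (simp add: card_insert_if)
    finally show False using card by simp
  qed
  \<comment> \<open>The third vertex \<open>w\<close> shares a side with \<open>u\<close> or with
    \<open>v\<close>; the one of them on the opposite side is then adjacent to both others.\<close>
  then obtain w where w: "w \<in> ?S" "w \<noteq> u" "w \<noteq> v" by blast
  note eq = tree_coloring_1_neighbours_eq[OF \<open>graph G\<close> tc i]
  from w SUV consider "w \<in> U" | "w \<in> V" by blast
  then show False
  proof cases
    case 1
    then show False using eq[of v u w] uv w parts(2) by auto
  next
    case 2
    then show False using eq[of u v w] uv w parts(2) by auto
  qed
qed

text \<open>Here \<open>x\<close> counts the indices assigned the value \<open>a\<close> and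
  \<open>y\<close> those assigned \<open>b\<close>; each new index increments one of the two
  counters.\<close>

lemma sum_two_values:
  fixes c :: "'i \<Rightarrow> nat"
  assumes "finite I" and "\<forall>i\<in>I. c i = a \<or> c i = b"
  shows "\<exists>x y. a * x + b * y = sum c I \<and> x + y = card I"
  using assms
proof (induction I)
  case empty
  then show ?case by simp
next
  case (insert i I)
  then obtain x y where xy: "a * x + b * y = sum c I" "x + y = card I" by auto
  from insert.prems consider "c i = a" | "c i = b" by blast
  then show ?case
  proof cases
    case 1
    then show ?thesis using insert.hyps xy by (intro exI[of _ "Suc x"] exI[of _ y]) simp
  next
    case 2
    then show ?thesis using insert.hyps xy by (intro exI[of _ x] exI[of _ "Suc y"]) simp
  qed
qed

text \<open>Color classes are pairwise disjoint, so it suffices that those indexed by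
  \<open>I\<close> have union \<open>U\<close>.\<close>

lemma card_eq_sum_color_classes:
  assumes "finite (verts G)" and "coloring q G f" and "U \<subseteq> verts G"
    and "I \<subseteq> {1..q}" and "\<forall>i\<in>I. color_class G f i \<subseteq> U"
    and "\<forall>i\<in>{1..q} - I. color_class G f i \<inter> U = {}"
  shows "card U = (\<Sum>i\<in>I. card (color_class G f i))"
proof -
  have "U = (\<Union>i\<in>I. color_class G f i)"
  proof (intro equalityI subsetI)
    fix v assume "v \<in> U"
    then have "f v \<in> {1..q}" "v \<in> color_class G f (f v)"
      using assms(2,3) unfolding coloring_def color_class_def by blast+
    \<comment> \<open>The class of color \<open>f v\<close> meets \<open>U\<close> in
      \<open>v\<close>, which forces \<open>f v\<close> into \<open>I\<close>.\<close>
    then show "v \<in> (\<Union>i\<in>I. color_class G f i)" using assms(6) \<open>v \<in> U\<close> by blast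
  qed (use assms(5) in blast)
  moreover have "finite I" using assms(4) by (rule finite_subset) simp
  ultimately show ?thesis
    using assms(1) by (simp add: card_UN_disjoint color_class_def disjoint_iff)
qed

theorem theorem4p2:
  fixes n a q :: nat and G :: "('a, 'b) pre_digraph"
  assumes "n \<ge> 1" and "a \<ge> 3" and "q \<ge> 1"
    and "K\<^bsub>n,n\<^esub> G"
    and "\<exists>f. tree_coloring q 1 1 G f \<and> equitable q G f \<and>
           (\<forall>i\<in>{1..q}. card (color_class G f i) = a \<or> card (color_class G f i) = a + 1)"
  shows "\<exists>x1 y1 x2 y2 :: nat. a * x1 + (a + 1) * y1 = n \<and> a * x2 + (a + 1) * y2 = n \<and>
           q = (x1 + y1) + (x2 + y2)"
proof -
  obtain f where tc: "tree_coloring q 1 1 G f"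
    and sizes: "\<forall>i\<in>{1..q}. card (color_class G f i) = a \<or> card (color_class G f i) = a + 1"
    using assms(5) by blast
  obtain U V where "graph G" and UV: "verts G = U \<union> V" "U \<inter> V = {}" "card U = n" "card V = n"
    "arcs_ends G = U \<times> V \<union> V \<times> U"
    using assms(4) unfolding complete_bipartite_digraph_def by blast
  interpret graph G by fact
  have col: "coloring q G f" using tc by (simp add: tree_coloring_def)
  define I where "I = {i \<in> {1..q}. color_class G f i \<subseteq> U}"
  \<comment> \<open>Taking the complement makes \<open>I\<close> and \<open>J\<close> partition the
    colors, so their cardinalities add up to \<open>q\<close>; that the classes of \<open>J\<close>
    lie in \<open>V\<close> is then proved from the size bound \<open>ge3\<close>.\<close>
  define J where "J = {1..q} - I"
  have ge3: "3 \<le> card (color_class G f i)" if "i \<in> {1..q}" for i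
    using sizes assms(2) that by fastforce
  have J: "color_class G f i \<subseteq> V" if "i \<in> J" for i
    using tree_coloring_1_class_in_part[OF \<open>graph G\<close> tc _ UV(1,5) ge3] that
    by (auto simp: I_def J_def)
  have IJ: "I \<subseteq> {1..q}" "J \<subseteq> {1..q}" "finite I" "finite J" by (auto simp: I_def J_def)
  \<comment> \<open>As \<open>U\<close> and \<open>V\<close> are disjoint, the classes indexed by
    \<open>J\<close> miss \<open>U\<close>; symmetrically, those indexed by \<open>I\<close> miss
    \<open>V\<close>.\<close>
  have "card U = (\<Sum>i\<in>I. card (color_class G f i))"
    using UV(1,2) J by (intro card_eq_sum_color_classes[OF finite_verts col])
      (fastforce simp: I_def J_def)+
  moreover have "card V = (\<Sum>i\<in>J. card (color_class G f i))"
    using UV(1,2) J by (intro card_eq_sum_color_classes[OF finite_verts col])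
      (fastforce simp: I_def J_def)+
  moreover obtain x1 y1 where "a * x1 + (a + 1) * y1 = (\<Sum>i\<in>I. card (color_class G f i))"
      "x1 + y1 = card I"
    using sum_two_values[OF IJ(3), of "\<lambda>i. card (color_class G f i)" a "a + 1"] sizes IJ(1) by blast
  moreover obtain x2 y2 where "a * x2 + (a + 1) * y2 = (\<Sum>i\<in>J. card (color_class G f i))"
      "x2 + y2 = card J"
    using sum_two_values[OF IJ(4), of "\<lambda>i. card (color_class G f i)" a "a + 1"] sizes IJ(2) by blast
  moreover have "q = card I + card J"
    using card_Diff_subset[OF IJ(3,1)] card_mono[OF _ IJ(1)] by (simp add: J_def)
  ultimately show ?thesis
    using UV(3,4) by (intro exI[of _ x1] exI[of _ y1] exI[of _ x2] exI[of _ y2]) simp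
qed

end
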